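(* Let $g$ be a smooth Riemannian metric near the origin of $\mathbb R^n$ with $g_{ij}(0)=\delta_{ij}$ and $\partial_kg_{ij}(0)=0$. Let $h_{ij}^\mu=h_{ji}^\mu$ ($1\le i,j\le n$, $1\le\mu\le n(n-1)/2$) be real constants satisfying $$R_{ijkl}(0)=\sum_{\mu=1}^{n(n-1)/2}\big(h_{ik}^\mu h_{jl}^\mu-h_{il}^\mu h_{jk}^\mu\big)\quad\text{for all }i,j,k,l,$$ put $h_{ij}=(h_{ij}^1,\dots,h_{ij}^{n(n-1)/2})$, assume that $\{h_{ij}\}_{1\le i<j\le n}$ is a basis of $\mathbb R^{n(n-1)/2}$, and define constants $c_k^{ij}=c_k^{ji}$ ($i\ne j$) by $$h_{kk}=-2\sum_{1\le i<j\le n}c_k^{ij}h_{ij},\qquad 1\le k\le n.$$ Set also $c_i^{ii}=1$ for all $i$ and $c_i^{jj}=0$ for $i\ne j$, and define $n\times n$ matrices $A^1,\dots,A^n$ by $(A^k)_{ij}=c_i^{kj}$. Let $u$ be the map $\mathbb R^n\to\mathbb R^{n(n+1)/2}$ with components $$u^l=x^l+\frac1{3!}\sum_{i,j,k}\alpha_{ijk}^lx^ix^jx^k\ (1\le l\le n),\qquad u^{n+\mu}=\frac12\sum_{i,j}h_{ij}^\mu x^ix^j\ (1\le\mu\le n(n-1)/2),$$ where the constants $\alpha_{ijk}^l$ are such that $du\cdot du-g=O(|x|^3)$ as $|x|\to0$. Then the reduced linearized system $$A^1(x)\partial_1V+\cdots+A^n(x)\partial_nV+B(x)V=F(x)$$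 associated with $u$ (defined in the context) is given at $x=0$ by $$A^1\partial_1V+\cdots+A^n\partial_nV=F,$$ that is, $A^k(0)=A^k$ for $k=1,\dots,n$ and $B(0)=0$, with $F=F(0)$.
   Context: Curvature convention: at the origin, where $\partial_kg_{ij}(0)=0$, $R_{ijkl}=\frac12(\partial_{il}g_{jk}+\partial_{jk}g_{il}-\partial_{ik}g_{jl}-\partial_{jl}g_{ik})$. Reduced linearized system associated with an embedding $u$ (near $0$) into $\mathbb R^{n(n+1)/2}$. Let $N_\mu$, $1\le\mu\le n(n-1)/2$, be a smooth orthonormal frame of the normal bundle of $u$; for $u$ as in the claim it is chosen so that $N_\mu(0)$ is the $(n+\mu)$-th standard basis vector. Let $\Gamma_{ij}^k$ be the Christoffel symbols of the induced metric $p_{ij}=\partial_iu\cdot\partial_ju$, and $H_{ij}^\mu=N_\mu\cdot\partial_{ij}u$. Enumerate pairs $1\le i<j\le n$ lexicographically by $\tau_{ij}=(i-1)n-\frac12i(i+1)+j\in\{1,\dots,n(n-1)/2\}$. Let $H(x)$ be the square matrix whose entry in row $\tau_{ij}$ ($i<j$) and column $\mu$ is $H_{ij}^\mu(x)$; assume it is invertible (this holds near $0$ for $u$ as in the claim), and write $H^{-1}=(H^{\mu\tau})$ with row index $\mu$ and column index $\tau$. The linearized isometric embedding equations are $\partial_iu\cdot\partial_jv+\partial_ju\cdot\partial_iv=f_{ij}$ ($1\le i,j\le n$), for a given smooth symmetric $(f_{ij})$ and unknown $v:\mathbb R^n\to\mathbb R^{n(n+1)/2}$. Writing $v=\sum_kv^k\partial_ku+\sum_\mu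 v^{n+\mu}N_\mu$ and $v_l=p_{lk}v^k$, these become $\partial_jv_i+\partial_iv_j-2\Gamma_{ij}^kv_k-2H_{ij}^\mu v^{n+\mu}=f_{ij}$. Solving the equations with $i<j$ algebraically for the $v^{n+\mu}$ and substituting in the equations with $i=j$ gives the reduced $n\times n$ system $\sum_kA^k(x)\partial_kV+B(x)V=F(x)$ for $V=(v_1,\dots,v_n)$, where (repeated $\mu$ summed) $$A^k_{ij}(x)=\begin{cases}-\frac12H_{ii}^\mu H^{\mu\tau_{jk}}&j<k,\\ \delta_{ik}&j=k,\\ -\frac12H_{ii}^\mu H^{\mu\tau_{kj}}&j>k,\end{cases}$$ $$B_{ij}(x)=-\Gamma_{ii}^j+\sum_{k<l}H_{ii}^\mu H^{\mu\tau_{kl}}\Gamma_{kl}^j,\qquad F_i(x)=\frac12\Big(f_{ii}-\sum_{k<l}H_{ii}^\mu H^{\mu\tau_{kl}}f_{kl}\Big).$$ *)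

theory Defs
  imports "HOL-Analysis.Analysis" "HOL-Library.Landau_Symbols"
begin

text \<open>
  The domain \<open>R^n\<close> is \<open>real ^ 'n\<close> and the target \<open>R^(n(n+1)/2)\<close> is \<open>real ^ 'm\<close>, where
  \<open>'n\<close> and \<open>'m\<close> are finite and linearly ordered; the i-th coordinate in the sense of \<open>1, 2, ...\<close>
  is the one whose index is the i-th smallest element of the type.  Normal indices
  \<open>1, ..., n(n-1)/2\<close> are natural numbers rather than elements of a type, because for
  \<open>n = 1\<close> there are none and a type cannot be empty.
\<close>

text \<open>\<open>real ^ 'n\<close> and \<open>real ^ 'n ^ 'n\<close>; the infix notation would add a clashing sort to \<open>'n\<close>.\<close>

type_synonym 'n rvec = "(real, 'n) vec"
type_synonym 'n rmat = "((real, 'n) vec, 'n) vec"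

definition pos :: "'a::{finite,linorder} \<Rightarrow> nat" where
  "pos a = card {b. b \<le> a}"

definition nth_index :: "nat \<Rightarrow> 'a::{finite,linorder}" where
  "nth_index k = (THE a. pos a = k)"

definition codim :: "'n::finite itself \<Rightarrow> nat" where
  "codim _ = CARD('n) * (CARD('n) - 1) div 2"

abbreviation normals :: "'n::finite itself \<Rightarrow> nat set" where
  "normals T \<equiv> {1..codim T}"

definition pairs :: "('n::{finite,linorder} \<times> 'n) set" where
  "pairs = {(i, j). i < j}"

text \<open>Subtraction comes last, so that it is not truncated when \<open>i < j\<close>.\<close>

definition tau :: "'n::{finite,linorder} \<Rightarrow> 'n \<Rightarrow> nat" where
  "tau i j = (pos i - 1) * CARD('n) + pos j - pos i * (pos i + 1) div 2"

definition pd :: "'n::finite \<Rightarrow> ('n rvec \<Rightarrow> 'b::real_normed_vector) \<Rightarrow> 'n rvec \<Rightarrow> 'b" where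
  "pd i f x = frechet_derivative f (at x) (axis i 1)"

primrec C_k_on :: "nat \<Rightarrow> (('n::finite) rvec) set \<Rightarrow> ('n rvec \<Rightarrow> 'b::real_normed_vector) \<Rightarrow> bool" where
  "C_k_on 0 S f \<longleftrightarrow> continuous_on S f"
| "C_k_on (Suc k) S f \<longleftrightarrow> (\<forall>x\<in>S. f differentiable at x) \<and> (\<forall>i. C_k_on k S (pd i f))"

definition smooth_on :: "(('n::finite) rvec) set \<Rightarrow> ('n rvec \<Rightarrow> 'b::real_normed_vector) \<Rightarrow> bool" where
  "smooth_on S f \<longleftrightarrow> open S \<and> (\<forall>k. C_k_on k S f)"

definition riemannian_metric_on :: "(('n::finite) rvec) set \<Rightarrow> ('n rvec \<Rightarrow> 'n rmat) \<Rightarrow> bool" where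
  "riemannian_metric_on S g \<longleftrightarrow> smooth_on S g \<and>
     (\<forall>x\<in>S. transpose (g x) = g x \<and> (\<forall>v. v \<noteq> 0 \<longrightarrow> v \<bullet> (g x *v v) > 0))"

text \<open>
  The curvature \<open>R_ijkl(0)\<close>, valid when the first derivatives of \<open>g\<close> vanish at the origin.
\<close>

definition curvature0 :: "(('n::finite) rvec \<Rightarrow> 'n rmat) \<Rightarrow> 'n \<Rightarrow> 'n \<Rightarrow> 'n \<Rightarrow> 'n \<Rightarrow> real" where
  "curvature0 g i j k l =
     (let D = (\<lambda>a b c d. pd a (pd b (\<lambda>x. g x $ c $ d)) 0)
      in (D i l j k + D j k i l - D i k j l - D j l i k) / 2)"

text \<open>
  A vector of \<open>R^(n(n-1)/2)\<close> is given by its components with index in \<open>normals\<close>.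
\<close>

definition is_basis :: "('n::{finite,linorder} \<Rightarrow> 'n \<Rightarrow> nat \<Rightarrow> real) \<Rightarrow> bool" where
  "is_basis h \<longleftrightarrow>
     (\<forall>a. (\<forall>\<mu>\<in>normals TYPE('n). (\<Sum>(i, j)\<in>pairs. a i j * h i j \<mu>) = 0) \<longrightarrow>
          (\<forall>(i, j)\<in>pairs. a i j = 0)) \<and>
     (\<forall>w. \<exists>a. \<forall>\<mu>\<in>normals TYPE('n). w \<mu> = (\<Sum>(i, j)\<in>pairs. a i j * h i j \<mu>))"

text \<open>
  Square matrices of size \<open>q\<close>, with row and column indices in \<open>{1..q}\<close>, as functions.
\<close>

definition inverse_matrices :: "nat \<Rightarrow> (nat \<Rightarrow> nat \<Rightarrow> real) \<Rightarrow> (nat \<Rightarrow> nat \<Rightarrow> real) \<Rightarrow> bool" where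
  "inverse_matrices q M K \<longleftrightarrow>
     (\<forall>a\<in>{1..q}. \<forall>b\<in>{1..q}.
        (\<Sum>c\<in>{1..q}. M a c * K c b) = (if a = b then 1 else 0) \<and>
        (\<Sum>c\<in>{1..q}. K a c * M c b) = (if a = b then 1 else 0))"

definition matrix_invertible :: "nat \<Rightarrow> (nat \<Rightarrow> nat \<Rightarrow> real) \<Rightarrow> bool" where
  "matrix_invertible q M \<longleftrightarrow> (\<exists>K. inverse_matrices q M K)"

definition matrix_inverse :: "nat \<Rightarrow> (nat \<Rightarrow> nat \<Rightarrow> real) \<Rightarrow> nat \<Rightarrow> nat \<Rightarrow> real" where
  "matrix_inverse q M = (SOME K. inverse_matrices q M K)"

definition induced_metric :: "(('n::finite) rvec \<Rightarrow> ('m::finite) rvec) \<Rightarrow> 'n rvec \<Rightarrow> 'n rmat" where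
  "induced_metric u x = (\<chi> i j. pd i u x \<bullet> pd j u x)"

text \<open>\<open>christoffel p k i j x\<close> is \<open>\<Gamma>_ij^k(x)\<close>.\<close>

definition christoffel :: "(('n::finite) rvec \<Rightarrow> 'n rmat) \<Rightarrow> 'n \<Rightarrow> 'n \<Rightarrow> 'n \<Rightarrow> 'n rvec \<Rightarrow> real" where
  "christoffel p k i j x =
     (\<Sum>l\<in>UNIV. matrix_inv (p x) $ k $ l *
        (pd i (\<lambda>y. p y $ j $ l) x + pd j (\<lambda>y. p y $ i $ l) x - pd l (\<lambda>y. p y $ i $ j) x)) / 2"

definition normal_frame_on ::
  "(('n::{finite,linorder}) rvec) set \<Rightarrow> ('n rvec \<Rightarrow> ('m::finite) rvec) \<Rightarrow>
   (nat \<Rightarrow> 'n rvec \<Rightarrow> 'm rvec) \<Rightarrow> bool" where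
  "normal_frame_on S u N \<longleftrightarrow>
     (\<forall>\<mu>\<in>normals TYPE('n). smooth_on S (N \<mu>)) \<and>
     (\<forall>x\<in>S. (\<forall>\<mu>\<in>normals TYPE('n). \<forall>\<nu>\<in>normals TYPE('n).
                 N \<mu> x \<bullet> N \<nu> x = (if \<mu> = \<nu> then 1 else 0)) \<and>
              span ((\<lambda>\<mu>. N \<mu> x) ` normals TYPE('n)) = {w. \<forall>i. w \<bullet> pd i u x = 0})"

definition second_form ::
  "(('n::finite) rvec \<Rightarrow> ('m::finite) rvec) \<Rightarrow> (nat \<Rightarrow> 'n rvec \<Rightarrow> 'm rvec) \<Rightarrow>
   'n \<Rightarrow> 'n \<Rightarrow> nat \<Rightarrow> 'n rvec \<Rightarrow> real" where
  "second_form u N i j \<mu> x = N \<mu> x \<bullet> pd i (pd j u) x"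

text \<open>Row \<open>t\<close> belongs to the pair \<open>i < j\<close> with \<open>tau i j = t\<close>.\<close>

definition H_matrix ::
  "(('n::{finite,linorder}) rvec \<Rightarrow> ('m::finite) rvec) \<Rightarrow> (nat \<Rightarrow> 'n rvec \<Rightarrow> 'm rvec) \<Rightarrow>
   'n rvec \<Rightarrow> nat \<Rightarrow> nat \<Rightarrow> real" where
  "H_matrix u N x t \<mu> =
     (case inv_into pairs (\<lambda>(i, j). tau i j) t of (i, j) \<Rightarrow> second_form u N i j \<mu> x)"

definition H_inverse ::
  "(('n::{finite,linorder}) rvec \<Rightarrow> ('m::finite) rvec) \<Rightarrow> (nat \<Rightarrow> 'n rvec \<Rightarrow> 'm rvec) \<Rightarrow>
   'n rvec \<Rightarrow> nat \<Rightarrow> nat \<Rightarrow> real" where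
  "H_inverse u N x = matrix_inverse (codim TYPE('n)) (H_matrix u N x)"

text \<open>\<open>H_product u N i j k x\<close> is the contraction of \<open>H_ii^\<mu>\<close> with \<open>H^(\<mu> tau_jk)\<close> over \<open>\<mu>\<close>.\<close>

definition H_product ::
  "(('n::{finite,linorder}) rvec \<Rightarrow> ('m::finite) rvec) \<Rightarrow> (nat \<Rightarrow> 'n rvec \<Rightarrow> 'm rvec) \<Rightarrow>
   'n \<Rightarrow> 'n \<Rightarrow> 'n \<Rightarrow> 'n rvec \<Rightarrow> real" where
  "H_product u N i j k x =
     (\<Sum>\<mu>\<in>normals TYPE('n). second_form u N i i \<mu> x * H_inverse u N x \<mu> (tau j k))"

definition reduced_A ::
  "(('n::{finite,linorder}) rvec \<Rightarrow> ('m::finite) rvec) \<Rightarrow> (nat \<Rightarrow> 'n rvec \<Rightarrow> 'm rvec) \<Rightarrow>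
   'n \<Rightarrow> 'n rvec \<Rightarrow> 'n rmat" where
  "reduced_A u N k x = (\<chi> i j.
     if j < k then - (1 / 2) * H_product u N i j k x
     else if j = k then (if i = k then 1 else 0)
     else - (1 / 2) * H_product u N i k j x)"

definition reduced_B ::
  "(('n::{finite,linorder}) rvec \<Rightarrow> ('m::finite) rvec) \<Rightarrow> (nat \<Rightarrow> 'n rvec \<Rightarrow> 'm rvec) \<Rightarrow>
   'n rvec \<Rightarrow> 'n rmat" where
  "reduced_B u N x = (\<chi> i j.
     - christoffel (induced_metric u) j i i x +
     (\<Sum>(k, l)\<in>pairs. H_product u N i k l x * christoffel (induced_metric u) j k l x))"

definition reduced_F ::
  "(('n::{finite,linorder}) rvec \<Rightarrow> ('m::finite) rvec) \<Rightarrow> (nat \<Rightarrow> 'n rvec \<Rightarrow> 'm rvec) \<Rightarrow>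
   ('n rvec \<Rightarrow> 'n rmat) \<Rightarrow> 'n rvec \<Rightarrow> 'n rvec" where
  "reduced_F u N f x = (\<chi> i.
     (1 / 2) * (f x $ i $ i - (\<Sum>(k, l)\<in>pairs. H_product u N i k l x * f x $ k $ l)))"

definition reduced_system_at ::
  "(('n::{finite,linorder}) rvec \<Rightarrow> ('m::finite) rvec) \<Rightarrow> (nat \<Rightarrow> 'n rvec \<Rightarrow> 'm rvec) \<Rightarrow>
   ('n rvec \<Rightarrow> 'n rmat) \<Rightarrow> ('n rvec \<Rightarrow> 'n rvec) \<Rightarrow> 'n rvec \<Rightarrow> bool" where
  "reduced_system_at u N f V x \<longleftrightarrow>
     (\<Sum>k\<in>UNIV. reduced_A u N k x *v pd k V x) + reduced_B u N x *v V x = reduced_F u N f x"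

end

theory Submission
  imports Defs
begin

text \<open>
  At the origin the map \<open>u\<close> separates tangential from normal directions completely.  Its first
  derivatives there are the first \<open>n\<close> standard basis vectors.  Its second derivatives have
  no component along these, since the tangential components of \<open>u\<close> carry no quadratic term,
  and their components along the normals \<open>N \<mu>\<close> are the constants \<open>h i j \<mu>\<close>.

  Two consequences follow.  The derivatives of the induced metric at the origin are sums of
  products of a first with a second derivative of \<open>u\<close>, so they vanish; hence the Christoffel
  symbols vanish and, with them, \<open>B(0)\<close> (\<open>christoffel_eq_0\<close>).  Moreover \<open>H(0)\<close> is the matrix with
  the rows \<open>h i j\<close>, \<open>i < j\<close>, which is invertible because these vectors form a basis
  (\<open>basis_imp_matrix_invertible\<close>).  Contracting a vector with \<open>H\<^sup>-\<^sup>1\<close> computes its coordinates in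
  this basis (\<open>H_product_eq_coefficient\<close>); for \<open>h i i\<close> they are by definition \<open>- 2 * c i j k\<close>, and the
  factor \<open>- 1 / 2\<close> in the formula for \<open>A\<close> turns them into \<open>c i j k\<close>.

  Invertibility persists near the origin because the entries of \<open>H\<close> are continuous there and
  invertibility is an open condition (\<open>eventually_matrix_invertible\<close>).  Determinants need a finite
  index type, while \<open>H\<close> is indexed by an initial segment of the natural numbers that may be empty;
  so \<open>H\<close> is first enlarged by an identity block.

  Every derivative of \<open>u\<close> is read off from one formula: a map with cubic polynomial
  components has partial derivatives of the same kind (\<open>pd_cubic_map\<close>).
\<close>

section \<open>Positions in a finite linear order\<close>

lemma two_codim: "2 * codim TYPE('n::finite) = CARD('n) * (CARD('n) - 1)"
proof -
  have "even (CARD('n) * (CARD('n) - 1))" by auto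
  then show ?thesis unfolding codim_def by simp
qed

lemma pos_less_iff: "pos (a::'a::{finite,linorder}) < pos b \<longleftrightarrow> a < b"
proof -
  have "pos x < pos y" if "x < y" for x y :: 'a
  proof -
    have "{b. b \<le> x} \<subset> {b. b \<le> y}"
      using that by (auto simp: psubset_eq set_eq_iff intro!: exI[of _ y])
    then show ?thesis unfolding pos_def by (intro psubset_card_mono) auto
  qed
  moreover have "pos x \<le> pos y" if "x \<le> y" for x y :: 'a
    unfolding pos_def using that by (intro card_mono) auto
  ultimately show ?thesis
    by (meson leD not_le)
qed

lemma bij_betw_pos: "bij_betw pos (UNIV::'a::{finite,linorder} set) {1..CARD('a)}"
proof -
  have inj: "inj (pos :: 'a \<Rightarrow> nat)"
    by (metis injI less_irrefl linorder_neqE pos_less_iff)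
  have "pos a \<in> {1..CARD('a)}" for a :: 'a
    unfolding pos_def by (auto intro: card_mono simp: Suc_le_eq card_gt_0_iff)
  hence "range (pos :: 'a \<Rightarrow> nat) \<subseteq> {1..CARD('a)}" by auto
  moreover have "card (range (pos :: 'a \<Rightarrow> nat)) = CARD('a)"
    using inj by (rule card_image)
  ultimately have "range (pos :: 'a \<Rightarrow> nat) = {1..CARD('a)}"
    by (intro card_subset_eq) auto
  with inj show ?thesis by (simp add: bij_betw_def)
qed

lemma pos_bounds: "1 \<le> pos (a::'a::{finite,linorder})" "pos a \<le> CARD('a)"
  using bij_betwE[OF bij_betw_pos] by fastforce+

lemma nth_index_pos [simp]: "nth_index (pos a) = a"
  unfolding nth_index_def
  by (rule the_equality) (use bij_betw_pos in \<open>auto simp: bij_betw_def dest: injD\<close>)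

lemma pos_nth_index:
  assumes "k \<in> {1..CARD('a::{finite,linorder})}"
  shows "pos (nth_index k :: 'a) = k"
  using assms bij_betw_imp_surj_on[OF bij_betw_pos[where 'a='a]] by (metis imageE nth_index_pos)

section \<open>Enumeration of pairs\<close>

lemma card_pairs: "card (pairs :: ('n::{finite,linorder} \<times> 'n) set) = codim TYPE('n)"
proof -
  let ?P = "pairs :: ('n \<times> 'n) set"
  have "(UNIV :: ('n \<times> 'n) set) = (?P \<union> prod.swap ` ?P) \<union> range (\<lambda>i. (i, i))"
    unfolding pairs_def by (auto simp: image_iff)
  then have "CARD('n \<times> 'n) = card ((?P \<union> prod.swap ` ?P) \<union> range (\<lambda>i. (i, i)))"
    by simp
  also have "\<dots> = card (?P \<union> prod.swap ` ?P) + card (range (\<lambda>i::'n. (i, i)))"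
    by (rule card_Un_disjoint) (auto simp: pairs_def)
  also have "card (?P \<union> prod.swap ` ?P) = card ?P + card (prod.swap ` ?P)"
    by (rule card_Un_disjoint) (auto simp: pairs_def)
  also have "card (range (\<lambda>i::'n. (i, i))) = CARD('n)"
    by (rule card_image) (auto intro: injI)
  also have "card (prod.swap ` ?P) = card ?P"
    by (rule card_image) simp
  finally have "2 * card ?P + CARD('n) = CARD('n) * CARD('n)"
    by simp
  then have "2 * card ?P = 2 * codim TYPE('n)"
    unfolding two_codim by (simp add: diff_mult_distrib2)
  then show ?thesis by simp
qed

text \<open>
  Doubling and passing to the integers removes both the division and the truncated
  subtraction from \<open>tau\<close>, so that the remaining facts are polynomial inequalities.
\<close>

lemma two_tau:
  assumes "(i::'n::{finite,linorder}) < j"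
  shows "2 * int (tau i j)
    = 2 * (int (pos i) - 1) * int CARD('n) + 2 * int (pos j) - int (pos i) * (int (pos i) + 1)"
proof -
  define p q n where "p = pos i" and "q = pos j" and "n = CARD('n)"
  have pq: "1 \<le> p" "p < q" "q \<le> n"
    using assms pos_bounds[of i] pos_bounds[of j] by (auto simp: p_def q_def n_def pos_less_iff)
  have even: "2 * (p * (p + 1) div 2) = p * (p + 1)" by simp
  have "int (p * (p + 1)) \<le> int (2 * ((p - 1) * n + q))"
  proof -
    \<comment> \<open>With \<open>q = p + 1\<close> the difference of the two sides is this product plus 2.\<close>
    have "0 \<le> (int p - 1) * (2 * int n - int p)"
      using pq by simp
    then have "int p * (int p + 1) \<le> 2 * ((int p - 1) * int n + int q)"
      using pq by (simp add: algebra_simps)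
    moreover have "int (2 * ((p - 1) * n + q)) = 2 * ((int p - 1) * int n + int q)"
      using pq by (cases p) simp_all
    moreover have "int (p * (p + 1)) = int p * (int p + 1)"
      by (simp add: algebra_simps)
    ultimately show ?thesis by linarith
  qed
  then have "p * (p + 1) \<le> 2 * ((p - 1) * n + q)"
    by (simp only: of_nat_le_iff)
  then have "p * (p + 1) div 2 \<le> (p - 1) * n + q"
    using div_le_mono[of "p * (p + 1)" "2 * ((p - 1) * n + q)" 2] by simp
  moreover have "2 * int (p * (p + 1) div 2) = int p * (int p + 1)"
    using arg_cong[OF even, of int] by (simp only: of_nat_mult of_nat_add of_nat_1 of_nat_numeral)
  ultimately show ?thesis
    using pq unfolding tau_def p_def[symmetric] q_def[symmetric] n_def[symmetric]
    by (cases p) (simp_all add: of_nat_diff algebra_simps)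
qed

lemma tau_bounds:
  assumes "(i::'n::{finite,linorder}) < j"
  shows "tau i j \<in> {1..codim TYPE('n)}"
proof -
  define p q n where "p = int (pos i)" and "q = int (pos j)" and "n = int CARD('n)"
  have pq: "1 \<le> p" "p < q" "q \<le> n"
    using assms pos_bounds[of i] pos_bounds[of j] by (auto simp: p_def q_def n_def pos_less_iff)
  have t: "2 * int (tau i j) = 2 * (p - 1) * n + 2 * q - p * (p + 1)"
    using two_tau[OF assms] by (simp add: p_def q_def n_def)
  \<comment> \<open>Within row \<open>p\<close>, \<open>tau\<close> is least at \<open>q = p + 1\<close> and greatest at \<open>q = n\<close>.\<close>
  have "0 \<le> (p - 1) * (2 * n - p)" using pq by simp
  then have "2 \<le> 2 * int (tau i j)" unfolding t using pq by (simp add: algebra_simps)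
  moreover have "0 \<le> (n - p) * (n - p - 1)" using pq by simp
  then have "2 * int (tau i j) \<le> n * (n - 1)" unfolding t using pq by (simp add: algebra_simps)
  moreover have "n * (n - 1) = 2 * int (codim TYPE('n))"
    using arg_cong[OF two_codim[where 'n='n], of int] by (simp add: n_def of_nat_diff Suc_le_eq)
  ultimately show ?thesis by simp
qed

lemma tau_less:
  assumes "(i::'n::{finite,linorder}) < j" "i' < j'" "i < i'"
  shows "tau i j < tau i' j'"
proof -
  define p q n where "p = int (pos i)" and "q = int (pos j)" and "n = int CARD('n)"
  define p' q' where "p' = int (pos i')" and "q' = int (pos j')"
  have pq: "p < q" "q \<le> n" "p' < q'" "q' \<le> n" "p < p'"
    using assms pos_bounds[of j] pos_bounds[of j']
    by (auto simp: p_def q_def n_def p'_def q'_def pos_less_iff)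
  have t: "2 * int (tau i j) = 2 * (p - 1) * n + 2 * q - p * (p + 1)"
    "2 * int (tau i' j') = 2 * (p' - 1) * n + 2 * q' - p' * (p' + 1)"
    using two_tau[OF assms(1)] two_tau[OF assms(2)] by (simp_all add: p_def q_def n_def p'_def q'_def)
  \<comment> \<open>The doubled difference is smallest for \<open>q = n\<close> and \<open>q' = p' + 1\<close>, where it equals this plus 2.\<close>
  have "0 \<le> 2 * ((p' - p - 1) * (n - p')) + (p' - p) * (p' - p - 1)" using pq by simp
  then have "2 * int (tau i j) < 2 * int (tau i' j')"
    unfolding t using pq by (simp add: algebra_simps)
  then show ?thesis by simp
qed

text \<open>Rows do not overlap and there are as many pairs as numbers, so surjectivity comes by counting.\<close>

lemma bij_betw_tau:
  "bij_betw (\<lambda>(i, j). tau i j) (pairs :: ('n::{finite,linorder} \<times> 'n) set) {1..codim TYPE('n)}"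
proof -
  let ?P = "pairs :: ('n \<times> 'n) set"
  have inj: "inj_on (\<lambda>(i, j). tau i j) ?P"
  proof (rule inj_onI, clarify)
    fix i j i' j' :: 'n
    assume P: "(i, j) \<in> ?P" "(i', j') \<in> ?P" and eq: "tau i j = tau i' j'"
    have lt: "i < j" "i' < j'" using P by (auto simp: pairs_def)
    have "i = i'" using tau_less[OF lt] tau_less[OF lt(2) lt(1)] eq by (metis less_irrefl linorder_neqE)
    moreover from this have "pos j = pos j'"
      using two_tau[OF lt(1)] two_tau[OF lt(2)] eq by simp
    then have "j = j'" by (metis nth_index_pos)
    ultimately show "i = i' \<and> j = j'" by simp
  qed
  have "(\<lambda>(i, j). tau i j) ` ?P \<subseteq> {1..codim TYPE('n)}"
    using tau_bounds[where 'n='n] by (auto simp: pairs_def)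
  then have "(\<lambda>(i, j). tau i j) ` ?P = {1..codim TYPE('n)}"
    by (intro card_subset_eq) (simp_all add: card_image[OF inj] card_pairs)
  with inj show ?thesis by (simp add: bij_betw_def)
qed

section \<open>Invertible matrices with natural number indices\<close>

text \<open>
  The block sum of \<open>M\<close>, placed on the indices \<open>e ` {1..q}\<close>, with an identity matrix on the others.
\<close>

definition extend_matrix ::
  "(nat \<Rightarrow> 'k::finite) \<Rightarrow> nat \<Rightarrow> (nat \<Rightarrow> nat \<Rightarrow> real) \<Rightarrow> real ^ 'k ^ 'k" where
  "extend_matrix e q M = (\<chi> r s.
     if r \<in> e ` {1..q} \<and> s \<in> e ` {1..q}
     then M (inv_into {1..q} e r) (inv_into {1..q} e s)
     else if r = s then 1 else 0)"

lemma extend_matrix_mult: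
  assumes e: "inj_on e {1..q}" and MK: "\<And>a b. a \<in> {1..q} \<Longrightarrow> b \<in> {1..q} \<Longrightarrow>
      (\<Sum>c\<in>{1..q}. M a c * K c b) = (if a = b then 1 else 0)"
  shows "extend_matrix e q M ** extend_matrix e q K = mat 1"
proof -
  let ?R = "e ` {1..q}"
  let ?M = "extend_matrix e q M" and ?K = "extend_matrix e q K"
  have "(\<Sum>t\<in>UNIV. ?M $ r $ t * ?K $ t $ s) = (if r = s then 1 else 0)" for r s
  proof (cases "r \<in> ?R \<and> s \<in> ?R")
    case True
    then obtain a b where ab: "a \<in> {1..q}" "b \<in> {1..q}" "r = e a" "s = e b" by blast
    have "(\<Sum>t\<in>UNIV. ?M $ r $ t * ?K $ t $ s) = (\<Sum>t\<in>?R. ?M $ r $ t * ?K $ t $ s)"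
      using True by (intro sum.mono_neutral_right) (auto simp: extend_matrix_def)
    also have "\<dots> = (\<Sum>c\<in>{1..q}. M a c * K c b)"
      using ab e by (simp add: sum.reindex extend_matrix_def)
    also have "\<dots> = (if r = s then 1 else 0)"
      using MK[OF ab(1,2)] ab e by (simp add: inj_on_eq_iff)
    finally show ?thesis .
  next
    case False
    have "?M $ r $ t * ?K $ t $ s = (if t = r then if r = s then 1 else 0 else 0)" for t
    proof (cases "r \<in> ?R")
      case True
      with False have "s \<notin> ?R" by simp
      with True show ?thesis by (cases "t = s"; cases "r = s") (simp_all add: extend_matrix_def)
    next
      case False
      then show ?thesis by (cases "t = r") (simp_all add: extend_matrix_def)
    qed
    then show ?thesis by simp
  qed
  then show ?thesis by (simp add: matrix_matrix_mult_def mat_def vec_eq_iff)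
qed

text \<open>
  In the rows and columns from \<open>e ` {1..q}\<close> the extended matrix vanishes outside its block.
  Hence the corresponding block of any inverse of it is an inverse of \<open>M\<close>.
\<close>

lemma invertible_extend_matrix:
  assumes e: "inj_on e {1..q}"
  shows "invertible (extend_matrix e q M) \<longleftrightarrow> matrix_invertible q M"
proof
  assume "matrix_invertible q M"
  then obtain K where "inverse_matrices q M K" unfolding matrix_invertible_def ..
  then show "invertible (extend_matrix e q M)"
    unfolding invertible_def inverse_matrices_def using extend_matrix_mult[OF e] by blast
next
  let ?M = "extend_matrix e q M"
  assume "invertible ?M"
  then obtain L where L: "?M ** L = mat 1" "L ** ?M = mat 1" unfolding invertible_def by blast
  let ?K = "\<lambda>a b. L $ e a $ e b"
  have "(\<Sum>c\<in>{1..q}. M a c * ?K c b) = (if a = b then 1 else 0)"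
       "(\<Sum>c\<in>{1..q}. ?K a c * M c b) = (if a = b then 1 else 0)"
    if ab: "a \<in> {1..q}" "b \<in> {1..q}" for a b
  proof -
    have "(\<Sum>c\<in>{1..q}. M a c * ?K c b) = (\<Sum>t\<in>e ` {1..q}. ?M $ e a $ t * L $ t $ e b)"
      using ab e by (simp add: sum.reindex extend_matrix_def)
    also have "\<dots> = (\<Sum>t\<in>UNIV. ?M $ e a $ t * L $ t $ e b)"
      using ab by (intro sum.mono_neutral_left) (auto simp: extend_matrix_def)
    also have "\<dots> = (?M ** L) $ e a $ e b" by (simp add: matrix_matrix_mult_def)
    finally show "(\<Sum>c\<in>{1..q}. M a c * ?K c b) = (if a = b then 1 else 0)"
      using ab e by (simp add: L mat_def inj_on_eq_iff)
    have "(\<Sum>c\<in>{1..q}. ?K a c * M c b) = (\<Sum>t\<in>e ` {1..q}. L $ e a $ t * ?M $ t $ e b)"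
      using ab e by (simp add: sum.reindex extend_matrix_def)
    also have "\<dots> = (\<Sum>t\<in>UNIV. L $ e a $ t * ?M $ t $ e b)"
      using ab by (intro sum.mono_neutral_left) (auto simp: extend_matrix_def)
    also have "\<dots> = (L ** ?M) $ e a $ e b" by (simp add: matrix_matrix_mult_def)
    finally show "(\<Sum>c\<in>{1..q}. ?K a c * M c b) = (if a = b then 1 else 0)"
      using ab e by (simp add: L mat_def inj_on_eq_iff)
  qed
  then show "matrix_invertible q M"
    unfolding matrix_invertible_def inverse_matrices_def by (intro exI[of _ ?K]) blast
qed

text \<open>
  The determinant is a polynomial in the entries, so a nonzero limit keeps it away from zero.
  The injection \<open>e\<close> only provides an index type that is large enough.
\<close>

lemma eventually_matrix_invertible:
  fixes e :: "nat \<Rightarrow> 'k::finite"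
  assumes e: "inj_on e {1..q}"
    and lim: "\<And>a b. a \<in> {1..q} \<Longrightarrow> b \<in> {1..q} \<Longrightarrow> ((\<lambda>x. M x a b) \<longlongrightarrow> M' a b) F"
    and inv: "matrix_invertible q M'"
  shows "\<forall>\<^sub>F x in F. matrix_invertible q (M x)"
proof -
  have "((\<lambda>x. extend_matrix e q (M x) $ r $ s) \<longlongrightarrow> extend_matrix e q M' $ r $ s) F" for r s
  proof (cases "r \<in> e ` {1..q} \<and> s \<in> e ` {1..q}")
    case True
    then show ?thesis by (simp only: extend_matrix_def vec_lambda_beta if_True simp_thms) (intro lim inv_into_into; simp)
  next
    case False
    then show ?thesis by (simp only: extend_matrix_def vec_lambda_beta if_False tendsto_const)
  qed
  then have "((\<lambda>x. det (extend_matrix e q (M x))) \<longlongrightarrow> det (extend_matrix e q M')) F"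
    unfolding det_def by (intro tendsto_sum tendsto_mult tendsto_prod tendsto_const)
  moreover have "det (extend_matrix e q M') \<noteq> 0"
    using inv invertible_extend_matrix[OF e] invertible_det_nz by blast
  ultimately have "\<forall>\<^sub>F x in F. det (extend_matrix e q (M x)) \<noteq> 0"
    by (rule tendsto_imp_eventually_ne)
  then show ?thesis
    by (simp add: invertible_extend_matrix[OF e] flip: invertible_det_nz)
qed

lemma inverse_matrices_matrix_inverse:
  "matrix_invertible q M \<Longrightarrow> inverse_matrices q M (matrix_inverse q M)"
  unfolding matrix_invertible_def matrix_inverse_def by (rule someI_ex[of "inverse_matrices q M"])

text \<open>
  Spanning writes the unit vectors as combinations of the rows, which gives \<open>K\<close> with \<open>K M = 1\<close>.
  Then \<open>(M K - 1) M = 0\<close> is a linear relation between the rows, so \<open>M K = 1\<close> by independence.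
\<close>

lemma basis_imp_matrix_invertible:
  fixes h :: "'n::{finite,linorder} \<Rightarrow> 'n \<Rightarrow> nat \<Rightarrow> real"
  assumes h: "is_basis h"
    and M: "\<And>i j \<mu>. (i, j) \<in> pairs \<Longrightarrow> \<mu> \<in> normals TYPE('n) \<Longrightarrow> M (tau i j) \<mu> = h i j \<mu>"
  shows "matrix_invertible (codim TYPE('n)) M"
proof -
  let ?q = "codim TYPE('n)"
  have reindex: "(\<Sum>t\<in>{1..?q}. f t) = (\<Sum>(i, j)\<in>pairs. f (tau (i::'n) j))" for f :: "nat \<Rightarrow> real"
    using sum.reindex_bij_betw[OF bij_betw_tau[where 'n='n], of f] by (simp add: case_prod_unfold)
  have indep: "\<forall>a. (\<forall>\<mu>\<in>{1..?q}. (\<Sum>(i, j)\<in>pairs. a i j * h i j \<mu>) = 0) \<longrightarrow>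
        (\<forall>(i, j)\<in>pairs. a i j = 0)"
    and span: "\<forall>w. \<exists>a. \<forall>\<mu>\<in>{1..?q}. w \<mu> = (\<Sum>(i, j)\<in>pairs. a i j * h i j \<mu>)"
    using h unfolding is_basis_def by (rule conjunct1, rule conjunct2)
  have "\<forall>\<nu>. \<exists>a. \<forall>\<mu>\<in>{1..?q}. (if \<nu> = \<mu> then 1 else 0) = (\<Sum>(i, j)\<in>pairs. a i j * h i j \<mu>)"
    by (intro allI span[THEN spec])
  from choice[OF this] obtain a where a: "\<And>\<nu> \<mu>. \<mu> \<in> {1..?q} \<Longrightarrow>
      (if \<nu> = \<mu> then 1 else 0) = (\<Sum>(i, j)\<in>pairs. a \<nu> i j * h i j \<mu>)"
    by blast
  define K where "K \<nu> t = (case inv_into pairs (\<lambda>(i, j). tau i j) t of (i, j) \<Rightarrow> a \<nu> i j)" for \<nu> t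
  have K: "K \<nu> (tau i j) = a \<nu> i j" if "(i, j) \<in> pairs" for \<nu> i j
    using inv_into_f_f[OF bij_betw_imp_inj_on[OF bij_betw_tau[where 'n='n]] that] by (simp add: K_def)
  have left: "(\<Sum>t\<in>{1..?q}. K \<nu> t * M t \<mu>) = (if \<nu> = \<mu> then 1 else 0)"
    if "\<mu> \<in> {1..?q}" for \<nu> \<mu>
  proof -
    have "(\<Sum>t\<in>{1..?q}. K \<nu> t * M t \<mu>) = (\<Sum>(i, j)\<in>pairs. a \<nu> i j * h i j \<mu>)"
      unfolding reindex using that by (intro sum.cong) (auto simp: K M)
    then show ?thesis using a[OF that] by simp
  qed
  have right: "(\<Sum>\<nu>\<in>{1..?q}. M t \<nu> * K \<nu> s) = (if t = s then 1 else 0)"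
    if ts: "t \<in> {1..?q}" "s \<in> {1..?q}" for t s
  proof -
    define D where "D s = (\<Sum>\<nu>\<in>{1..?q}. M t \<nu> * K \<nu> s) - (if t = s then 1 else 0)" for s
    have "(\<Sum>(i, j)\<in>pairs. D (tau i j) * h i j \<mu>) = 0" if \<mu>: "\<mu> \<in> {1..?q}" for \<mu>
    proof -
      have "(\<Sum>(i, j)\<in>pairs. D (tau i j) * h i j \<mu>) = (\<Sum>s\<in>{1..?q}. D s * M s \<mu>)"
        unfolding reindex using \<mu> by (intro sum.cong) (auto simp: M)
      also have "\<dots> = (\<Sum>s\<in>{1..?q}. \<Sum>\<nu>\<in>{1..?q}. M t \<nu> * (K \<nu> s * M s \<mu>))
          - (\<Sum>s\<in>{1..?q}. (if t = s then 1 else 0) * M s \<mu>)"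
        by (simp add: D_def left_diff_distrib sum_subtractf sum_distrib_right mult.assoc)
      also have "(\<Sum>s\<in>{1..?q}. (if t = s then 1 else 0) * M s \<mu>) = M t \<mu>"
        using ts by (simp add: if_distrib[of "\<lambda>x. x * _"] cong: if_cong)
      also have "(\<Sum>s\<in>{1..?q}. \<Sum>\<nu>\<in>{1..?q}. M t \<nu> * (K \<nu> s * M s \<mu>))
          = (\<Sum>\<nu>\<in>{1..?q}. M t \<nu> * (\<Sum>s\<in>{1..?q}. K \<nu> s * M s \<mu>))"
        by (subst sum.swap) (simp add: sum_distrib_left)
      also have "\<dots> = M t \<mu>"
        unfolding left[OF \<mu>] using \<mu> by (simp add: if_distrib[of "\<lambda>x. _ * x"] cong: if_cong)
      finally show ?thesis by simp
    qed
    then have "\<forall>(i, j)\<in>(pairs :: ('n \<times> 'n) set). D (tau i j) = 0"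
      using indep[THEN spec, of "\<lambda>i j. D (tau i j)"] by blast
    moreover obtain i j :: 'n where "(i, j) \<in> pairs" "s = tau i j"
      using ts(2) unfolding bij_betw_imp_surj_on[OF bij_betw_tau[where 'n='n], symmetric] by auto
    ultimately show ?thesis by (auto simp: D_def)
  qed
  show ?thesis
    unfolding matrix_invertible_def inverse_matrices_def using left right by (intro exI[of _ K]) blast
qed

section \<open>Maps with cubic polynomial components\<close>

text \<open>
  The coefficients are not required to be symmetric, so that the class contains the maps in
  question as they are given, and is closed under partial derivatives by a formula without
  case distinctions.
\<close>

definition cubic_map ::
  "('m \<Rightarrow> real) \<Rightarrow> ('m \<Rightarrow> 'n \<Rightarrow> real) \<Rightarrow> ('m \<Rightarrow> 'n \<Rightarrow> 'n \<Rightarrow> real) \<Rightarrow>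
   ('m \<Rightarrow> 'n \<Rightarrow> 'n \<Rightarrow> 'n \<Rightarrow> real) \<Rightarrow> ('n::finite) rvec \<Rightarrow> ('m::finite) rvec" where
  "cubic_map a b c d x = (\<chi> m. a m + (\<Sum>i\<in>UNIV. b m i * x $ i)
     + (\<Sum>i\<in>UNIV. \<Sum>j\<in>UNIV. c m i j * x $ i * x $ j)
     + (\<Sum>i\<in>UNIV. \<Sum>j\<in>UNIV. \<Sum>k\<in>UNIV. d m i j k * x $ i * x $ j * x $ k))"

lemma cubic_map_0 [simp]: "cubic_map a b c d 0 $ m = a m"
  by (simp add: cubic_map_def)

lemma has_derivative_cubic_map:
  "(cubic_map a b c d has_derivative (\<lambda>v. \<chi> m. (\<Sum>i\<in>UNIV. b m i * v $ i)
     + (\<Sum>i\<in>UNIV. \<Sum>j\<in>UNIV. c m i j * (x $ i * v $ j + v $ i * x $ j))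
     + (\<Sum>i\<in>UNIV. \<Sum>j\<in>UNIV. \<Sum>k\<in>UNIV.
          d m i j k * (x $ i * x $ j * v $ k + x $ i * v $ j * x $ k + v $ i * x $ j * x $ k)))) (at x)"
proof -
  have nth: "((\<lambda>x. x $ i) has_derivative (\<lambda>v. v $ i)) (at x)" for i
    by (rule bounded_linear_imp_has_derivative[OF bounded_linear_vec_nth])
  show ?thesis
    unfolding cubic_map_def has_derivative_componentwise_within[of "\<lambda>x. vec_lambda (_ x)"]
    by (auto simp: Basis_vec_def inner_axis algebra_simps sum.distrib
        intro!: derivative_eq_intros nth)
qed

lemma continuous_cubic_map: "continuous_on S (cubic_map a b c d)"
  by (meson has_derivative_continuous has_derivative_cubic_map continuous_at_imp_continuous_on)

lemma pd_cubic_map: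
  fixes p :: "'n::finite"
  shows "pd p (cubic_map a b c d) = cubic_map (\<lambda>m. b m p) (\<lambda>m j. c m p j + c m j p)
     (\<lambda>m j k. d m p j k + d m j p k + d m j k p) (\<lambda>m i j k. 0)"
proof
  fix x
  have sum_if: "(\<Sum>k\<in>UNIV. if P then f k else 0) = (if P then (\<Sum>k\<in>UNIV. f k) else 0)"
    for P and f :: "'n \<Rightarrow> real" by simp
  have ax: "axis p 1 $ i = (if i = p then 1 else (0::real))" for i by (simp add: axis_def)
  show "pd p (cubic_map a b c d) x = cubic_map (\<lambda>m. b m p) (\<lambda>m j. c m p j + c m j p)
     (\<lambda>m j k. d m p j k + d m j p k + d m j k p) (\<lambda>m i j k. 0) x"
    unfolding pd_def frechet_derivative_at[OF has_derivative_cubic_map, symmetric]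
    by (simp add: cubic_map_def vec_eq_iff ax distrib_left distrib_right sum.distrib 
        if_distrib[of "\<lambda>x. x * _"] if_distrib[of "\<lambda>x. _ * x"] mult.assoc sum_if cong: if_cong)
qed

section \<open>Coefficients of the reduced system\<close>

lemma pd_inner:
  fixes f g :: "('n::finite) rvec \<Rightarrow> 'b::real_inner"
  assumes "f differentiable at x" "g differentiable at x"
  shows "pd i (\<lambda>y. f y \<bullet> g y) x = f x \<bullet> pd i g x + pd i f x \<bullet> g x"
proof -
  have "((\<lambda>y. f y \<bullet> g y) has_derivative
      (\<lambda>v. f x \<bullet> frechet_derivative g (at x) v + frechet_derivative f (at x) v \<bullet> g x)) (at x)"
    using assms by (intro has_derivative_inner) (simp_all flip: frechet_derivative_works)
  then show ?thesis
    unfolding pd_def by (simp flip: frechet_derivative_at)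
qed

text \<open>
  By the product rule, each derivative of the induced metric is a sum of two inner products of a
  first with a second derivative of \<open>u\<close>.
\<close>

lemma christoffel_eq_0:
  assumes diff: "\<And>i. pd i u differentiable at x"
    and orth: "\<And>i j k. pd i u x \<bullet> pd j (pd k u) x = 0"
  shows "christoffel (induced_metric u) k i j x = 0"
proof -
  have "pd l (\<lambda>y. induced_metric u y $ i $ j) x = 0" for i j l
    by (simp add: induced_metric_def pd_inner diff orth inner_commute[of "pd l (pd i u) x"])
  then show ?thesis by (simp add: christoffel_def)
qed

lemma H_matrix_tau:
  assumes "(i, j) \<in> pairs"
  shows "H_matrix u N x (tau i j) \<mu> = second_form u N i j \<mu> x"
  using inv_into_f_f[OF bij_betw_imp_inj_on[OF bij_betw_tau] assms] by (simp add: H_matrix_def)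

text \<open>
  The vectors \<open>second_form u N k l\<close> with \<open>k < l\<close> are the rows of \<open>H\<close>, so contraction with column
  \<open>tau j k\<close> of the inverse extracts from a combination of them the coefficient of the pair \<open>(j, k)\<close>.
\<close>

lemma H_product_eq_coefficient:
  fixes u :: "('n::{finite,linorder}) rvec \<Rightarrow> ('m::finite) rvec"
  assumes inv: "matrix_invertible (codim TYPE('n)) (H_matrix u N x)"
    and expand: "\<And>\<mu>. \<mu> \<in> normals TYPE('n) \<Longrightarrow>
      second_form u N i i \<mu> x = (\<Sum>(k, l)\<in>pairs. a k l * second_form u N k l \<mu> x)"
    and jk: "(j, k) \<in> pairs"
  shows "H_product u N i j k x = a j k"
proof -
  let ?I = "normals TYPE('n)"
  have row: "(\<Sum>\<mu>\<in>?I. second_form u N p r \<mu> x * H_inverse u N x \<mu> (tau j k))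
      = (if (p, r) = (j, k) then 1 else 0)" if pr: "(p, r) \<in> pairs" for p r
  proof -
    have "tau p r \<in> ?I" "tau j k \<in> ?I"
      using pr jk by (simp_all only: pairs_def mem_Collect_eq case_prod_conv tau_bounds)
    then have "(\<Sum>\<mu>\<in>?I. H_matrix u N x (tau p r) \<mu> * H_inverse u N x \<mu> (tau j k))
        = (if tau p r = tau j k then 1 else 0)"
      using inverse_matrices_matrix_inverse[OF inv]
      unfolding inverse_matrices_def H_inverse_def by blast
    moreover have "tau p r = tau j k \<longleftrightarrow> (p, r) = (j, k)"
      using inj_on_eq_iff[OF bij_betw_imp_inj_on[OF bij_betw_tau] pr jk] by simp
    ultimately show ?thesis by (simp add: H_matrix_tau[OF pr])
  qed
  have "H_product u N i j k x
      = (\<Sum>\<mu>\<in>?I. \<Sum>(p, r)\<in>pairs. a p r * (second_form u N p r \<mu> x * H_inverse u N x \<mu> (tau j k)))"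
    unfolding H_product_def
    by (intro sum.cong refl) (simp add: expand sum_distrib_right case_prod_unfold mult.assoc)
  also have "\<dots> = (\<Sum>(p, r)\<in>pairs. a p r *
      (\<Sum>\<mu>\<in>?I. second_form u N p r \<mu> x * H_inverse u N x \<mu> (tau j k)))"
    by (subst sum.swap) (simp add: sum_distrib_left case_prod_unfold)
  also have "\<dots> = (\<Sum>s\<in>pairs. if s = (j, k) then a j k else 0)"
    by (rule sum.cong[OF refl], clarify) (simp add: row[unfolded One_nat_def])
  also have "\<dots> = a j k"
    using jk by simp
  finally show ?thesis .
qed

lemma continuous_second_form:
  assumes "open W" "continuous_on W (N \<mu>)" "continuous_on W (pd i (pd j u))"
    and x: "x \<in> W"
  shows "(second_form u N i j \<mu> \<longlongrightarrow> second_form u N i j \<mu> x) (nhds x)"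
proof -
  have "continuous_on W (second_form u N i j \<mu>)"
    unfolding second_form_def using assms by (intro continuous_intros)
  then show ?thesis
    using assms(1) x by (simp add: continuous_on_eq_continuous_at isCont_def tendsto_at_iff_tendsto_nhds)
qed

section \<open>The reduced system at the origin\<close>

lemma card_target_eq:
  assumes "CARD('m) = CARD('n) * (CARD('n) + 1) div 2"
  shows "CARD('m::finite) = CARD('n::finite) + codim TYPE('n)"
proof -
  have "CARD('n) * (CARD('n) + 1) = 2 * CARD('n) + CARD('n) * (CARD('n) - 1)"
    by (cases "CARD('n)") simp_all
  then have "CARD('n) * (CARD('n) + 1) = 2 * (CARD('n) + codim TYPE('n))"
    unfolding two_codim[symmetric] by simp
  then show ?thesis using assms by simp
qed

theorem lemma3p1:
  fixes g :: "('n::{finite,linorder}) rvec \<Rightarrow> 'n rmat"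
    and h :: "'n \<Rightarrow> 'n \<Rightarrow> nat \<Rightarrow> real"
    and c :: "'n \<Rightarrow> 'n \<Rightarrow> 'n \<Rightarrow> real"
    and \<alpha> :: "'n \<Rightarrow> 'n \<Rightarrow> 'n \<Rightarrow> 'n \<Rightarrow> real"
    and A :: "'n \<Rightarrow> 'n rmat"
    and u :: "'n rvec \<Rightarrow> ('m::{finite,linorder}) rvec"
    and N :: "nat \<Rightarrow> 'n rvec \<Rightarrow> 'm rvec"
    and U W :: "('n rvec) set"
  assumes target_dim: "CARD('m) = CARD('n) * (CARD('n) + 1) div 2"
    and metric: "0 \<in> U" "riemannian_metric_on U g"
    and metric_0: "g 0 = mat 1"
    and metric_deriv_0: "\<And>i j k. pd k (\<lambda>x. g x $ i $ j) 0 = 0"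
    and h_sym: "\<And>i j \<mu>. \<mu> \<in> normals TYPE('n) \<Longrightarrow> h i j \<mu> = h j i \<mu>"
    and gauss: "\<And>i j k l. curvature0 g i j k l =
      (\<Sum>\<mu>\<in>normals TYPE('n). h i k \<mu> * h j l \<mu> - h i l \<mu> * h j k \<mu>)"
    and basis: "is_basis h"
    and c_sym: "\<And>i j k. i \<noteq> j \<Longrightarrow> c k i j = c k j i"
    and c_def: "\<And>k \<mu>. \<mu> \<in> normals TYPE('n) \<Longrightarrow>
      h k k \<mu> = - 2 * (\<Sum>(i, j)\<in>pairs. c k i j * h i j \<mu>)"
    and c_diag: "\<And>i. c i i i = 1" "\<And>i j. i \<noteq> j \<Longrightarrow> c i j j = 0"
    and A_def: "\<And>k. A k = (\<chi> i j. c i k j)"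
    and u_tangential: "\<And>x l. u x $ nth_index (pos l) =
      x $ l + 1 / fact 3 *
        (\<Sum>i\<in>UNIV. \<Sum>j\<in>UNIV. \<Sum>k\<in>UNIV. \<alpha> l i j k * x $ i * x $ j * x $ k)"
    and u_normal: "\<And>x \<mu>. \<mu> \<in> normals TYPE('n) \<Longrightarrow> u x $ nth_index (CARD('n) + \<mu>) =
      1 / 2 * (\<Sum>i\<in>UNIV. \<Sum>j\<in>UNIV. h i j \<mu> * x $ i * x $ j)"
    and approx: "\<And>i j. (\<lambda>x. induced_metric u x $ i $ j - g x $ i $ j) \<in> O[at 0](\<lambda>x. norm x ^ 3)"
    and frame: "0 \<in> W" "open W" "normal_frame_on W u N"
    and frame_0: "\<And>\<mu>. \<mu> \<in> normals TYPE('n) \<Longrightarrow> N \<mu> 0 = axis (nth_index (CARD('n) + \<mu>)) 1"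
  shows "(\<forall>\<^sub>F x in nhds 0. matrix_invertible (codim TYPE('n)) (H_matrix u N x)) \<and>
    (\<forall>k. reduced_A u N k 0 = A k) \<and>
    reduced_B u N 0 = 0 \<and>
    (\<forall>S f V. 0 \<in> S \<and> smooth_on S f \<and> (\<forall>x\<in>S. transpose (f x) = f x) \<and> smooth_on S V \<longrightarrow>
      (reduced_system_at u N f V 0 \<longleftrightarrow> (\<Sum>k\<in>UNIV. A k *v pd k V 0) = reduced_F u N f 0))"
proof -
  let ?n = "CARD('n)" and ?q = "codim TYPE('n)"
  let ?t = "\<lambda>l::'n. nth_index (pos l) :: 'm" and ?e = "\<lambda>\<mu>. nth_index (?n + \<mu>) :: 'm"
  have card_m: "CARD('m) = ?n + ?q"
    using target_dim by (rule card_target_eq)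
  have pos_t: "pos (?t l) = pos l" for l
    using pos_bounds[of l] by (intro pos_nth_index) (simp add: card_m)
  have pos_e: "pos (?e \<mu>) = ?n + \<mu>" if "\<mu> \<in> {1..?q}" for \<mu>
    using that by (intro pos_nth_index) (simp add: card_m)
  have inj_e: "inj_on ?e {1..?q}"
    by (rule inj_onI) (metis pos_e add_left_cancel)
  have index_cases: "(\<exists>l. m = ?t l) \<or> (\<exists>\<mu>\<in>{1..?q}. m = ?e \<mu>)" for m :: 'm
  proof (cases "pos m \<le> ?n")
    case True
    then have "m = ?t (nth_index (pos m))"
      using pos_bounds(1)[of m] by (simp add: pos_nth_index)
    then show ?thesis by blast
  next
    case False
    then have "m = ?e (pos m - ?n)" "pos m - ?n \<in> {1..?q}"
      using pos_bounds(2)[of m] by (simp_all add: card_m) arith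
    then show ?thesis by blast
  qed
  \<comment> \<open>The coefficients of \<open>u\<close>; indices up to \<open>n\<close> are tangential and the others normal.\<close>
  define b :: "'m \<Rightarrow> 'n \<Rightarrow> real"
    where "b m i = (if m = ?t i then 1 else 0)" for m i
  define b2 :: "'m \<Rightarrow> 'n \<Rightarrow> 'n \<Rightarrow> real"
    where "b2 m i j = (if pos m \<le> ?n then 0 else h i j (pos m - ?n) / 2)" for m i j
  define b3 :: "'m \<Rightarrow> 'n \<Rightarrow> 'n \<Rightarrow> 'n \<Rightarrow> real"
    where "b3 m i j k = (if pos m \<le> ?n then \<alpha> (nth_index (pos m)) i j k / fact 3 else 0)" for m i j k
  have t: "b (?t l) i = (if l = i then 1 else 0)" "b2 (?t l) i j = 0"
      "b3 (?t l) i j k = \<alpha> l i j k / fact 3" for l i j k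
    using pos_bounds[of l] nth_index_pos
    by (simp_all add: b_def b2_def b3_def pos_t) (metis pos_t nth_index_pos)
  have e: "b (?e \<mu>) i = 0" "b2 (?e \<mu>) i j = h i j \<mu> / 2" "b3 (?e \<mu>) i j k = 0"
    if "\<mu> \<in> {1..?q}" for \<mu> i j k
  proof -
    have "?e \<mu> \<noteq> ?t i"
      using pos_e[OF that] pos_t[of i] pos_bounds(2)[of i] that by auto
    then show "b (?e \<mu>) i = 0" "b2 (?e \<mu>) i j = h i j \<mu> / 2" "b3 (?e \<mu>) i j k = 0"
      using that by (simp_all add: b_def b2_def b3_def pos_e)
  qed
  have u: "u = cubic_map (\<lambda>m. 0) b b2 b3"
  proof (rule ext, unfold vec_eq_iff, rule allI)
    fix x m
    consider l where "m = ?t l" | \<mu> where "\<mu> \<in> {1..?q}" "m = ?e \<mu>"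
      using index_cases[of m] by blast
    then show "u x $ m = cubic_map (\<lambda>m. 0) b b2 b3 x $ m"
    proof cases
      case (1 l)
      have "(\<Sum>i\<in>UNIV. (if l = i then 1 else 0) * x $ i) = x $ l"
        by (simp add: if_distrib[of "\<lambda>y. y * _"] cong: if_cong)
      then show ?thesis
        by (simp add: 1 u_tangential cubic_map_def t sum_distrib_left)
    next
      case (2 \<mu>)
      then show ?thesis
        by (simp only: 2(2) u_normal[OF 2(1)] cubic_map_def vec_lambda_beta e)
          (simp add: sum_distrib_left)
    qed
  qed
  have du: "pd i u 0 $ m = b m i" for i m
    by (simp add: u pd_cubic_map)
  have ddu: "pd i (pd j u) 0 $ m = b2 m j i + b2 m i j" for i j m
    by (simp add: u pd_cubic_map)
  have orth: "pd i u 0 \<bullet> pd j (pd k u) 0 = 0" for i j k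
  proof -
    \<comment> \<open>Linear terms occur only in tangential components and quadratic ones only in normal components.\<close>
    have "b m i * (b2 m k j + b2 m j k) = 0" for m
      using index_cases[of m] t(2) e(1) by auto
    then show ?thesis unfolding inner_vec_def inner_real_def du ddu by (intro sum.neutral) blast
  qed
  have "pd i u differentiable at 0" for i
    unfolding u pd_cubic_map differentiable_def using has_derivative_cubic_map by blast
  then have christoffel: "christoffel (induced_metric u) k i j 0 = 0" for k i j
    using orth by (rule christoffel_eq_0)
  have H0: "second_form u N i j \<mu> 0 = h i j \<mu>" if "\<mu> \<in> {1..?q}" for i j \<mu>
    using that h_sym[OF that, of i j]
    by (simp add: second_form_def frame_0 inner_commute[of "axis _ _"] inner_axis ddu e)
  have inv0: "matrix_invertible ?q (H_matrix u N 0)"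
    using basis by (rule basis_imp_matrix_invertible) (simp add: H_matrix_tau H0)
  have "((\<lambda>x. H_matrix u N x s \<mu>) \<longlongrightarrow> H_matrix u N 0 s \<mu>) (nhds 0)" if "\<mu> \<in> {1..?q}" for s \<mu>
  proof -
    have "C_k_on 0 W (N \<mu>)"
      using frame(3) that unfolding normal_frame_on_def smooth_on_def by blast
    then have "(second_form u N i j \<mu> \<longlongrightarrow> second_form u N i j \<mu> 0) (nhds 0)" for i j
      using frame(1,2)
      by (intro continuous_second_form) (simp_all add: u pd_cubic_map continuous_cubic_map)
    then show ?thesis
      unfolding H_matrix_def by (cases "inv_into pairs (\<lambda>(i, j). tau i j) s :: 'n \<times> 'n") simp
  qed
  then have invertible: "\<forall>\<^sub>F x in nhds 0. matrix_invertible ?q (H_matrix u N x)"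
    by (intro eventually_matrix_invertible[OF inj_e _ inv0])
  have prod: "H_product u N i j k 0 = - 2 * c i j k" if "j < k" for i j k
    using inv0
  proof (rule H_product_eq_coefficient)
    show "(j, k) \<in> pairs" using that by (simp add: pairs_def)
    show "second_form u N i i \<mu> 0 = (\<Sum>(p, r)\<in>pairs. (- 2 * c i p r) * second_form u N p r \<mu> 0)"
      if "\<mu> \<in> {1..?q}" for \<mu>
      by (simp add: H0[OF that] c_def[OF that] sum_distrib_left case_prod_unfold mult.assoc)
  qed
  have A: "reduced_A u N k 0 = A k" for k
    using c_diag c_sym by (auto simp: reduced_A_def A_def vec_eq_iff prod)
  have B: "reduced_B u N 0 = 0"
    by (simp add: reduced_B_def vec_eq_iff christoffel case_prod_unfold)
  show ?thesis
    using invertible by (simp add: A B reduced_system_at_def)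
qed

end
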